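(* Let $G$ be a group acting by automorphisms of a group $V$, let $\Gamma$ be a subgroup of $G$ leaving a subgroup $V_0$ of $V$ invariant, and suppose that $(V\rtimes G,V_0\rtimes\Gamma)$ is a Hecke pair. Let $S=\{s\in G\mid V_0\subset s(V_0)\}$. Then $S$ is a semigroup containing $\Gamma$ and the map $$\iota:[s]_\Gamma\in\mathcal H(S,\Gamma)\mapsto[s]_{V_0\rtimes\Gamma}\in\mathcal H(V\rtimes G,V_0\rtimes\Gamma)$$ extends by linearity to an injective homomorphism.
   Context: A pair $(N,N_0)$ of a group and a subgroup is a Hecke pair if $[N_0:N_0\cap xN_0x^{-1}]<\infty$ for all $x\in N$. The Hecke algebra $\mathcal H(N,N_0)$ is the space of complex $N_0$-biinvariant functions on $N$ supported on finitely many double cosets, with product $(f_1*f_2)(x)=\sum_{y\in N_0\backslash N}f_1(xy^{-1})f_2(y)$; $[x]_{N_0}$ is the characteristic function of $N_0xN_0$. If $S$ is a subsemigroup of $N$ containing $N_0$, $\mathcal H(S,N_0)$ is the subalgebra of $\mathcal H(N,N_0)$ of functions supported on double cosets of elements of $S$. (When $(V\rtimes G,V_0\rtimes\Gamma)$ is a Hecke pair, so is $(G,\Gamma)$, and here $\mathcal H(S,\Gamma)\subset\mathcal H(G,\Gamma)$.) Homomorphism means algebra homomorphism (no involution is considered on $\mathcal H(S,\Gamma)$). Semidirect products: $(v,g)(w,h)=(v\,g(w),gh)$; $V$ and $G$ are identified with their images in $V\rtimes G$. *)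

theory Defs
  imports Complex_Main "HOL-Library.Indicator_Function" "HOL-Algebra.Algebra"
begin

text \<open>The action of \<open>G\<close> on \<open>V\<close> by automorphisms is given by a homomorphism \<open>\<alpha>\<close> from \<open>G\<close> to
  \<open>AutoGroup V\<close>.\<close>

definition semidirect ::
  "('v, 'm) monoid_scheme \<Rightarrow> ('g, 'n) monoid_scheme \<Rightarrow> ('g \<Rightarrow> 'v \<Rightarrow> 'v) \<Rightarrow> ('v \<times> 'g) monoid"
  where "semidirect V G \<alpha> =
    \<lparr>carrier = carrier V \<times> carrier G,
     monoid.mult = (\<lambda>(v, g) (w, h). (v \<otimes>\<^bsub>V\<^esub> \<alpha> g w, g \<otimes>\<^bsub>G\<^esub> h)),
     one = (\<one>\<^bsub>V\<^esub>, \<one>\<^bsub>G\<^esub>)\<rparr>"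

definition subsemigroup :: "'a set \<Rightarrow> ('a, 'm) monoid_scheme \<Rightarrow> bool"
  where "subsemigroup S N \<longleftrightarrow> S \<subseteq> carrier N \<and> (\<forall>s\<in>S. \<forall>t\<in>S. s \<otimes>\<^bsub>N\<^esub> t \<in> S)"

text \<open>Finiteness of the index is finiteness of the set of cosets; \<open>N\<lparr>carrier := N0\<rparr>\<close> is
  \<open>N0\<close> regarded as a group.\<close>

definition hecke_pair :: "('a, 'm) monoid_scheme \<Rightarrow> 'a set \<Rightarrow> bool"
  where "hecke_pair N N0 \<longleftrightarrow> group N \<and> subgroup N0 N \<and>
    (\<forall>x\<in>carrier N.
      finite (rcosets\<^bsub>N\<lparr>carrier := N0\<rparr>\<^esub> (N0 \<inter> (x <#\<^bsub>N\<^esub> N0 #>\<^bsub>N\<^esub> inv\<^bsub>N\<^esub> x))))"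

definition double_coset :: "('a, 'm) monoid_scheme \<Rightarrow> 'a set \<Rightarrow> 'a \<Rightarrow> 'a set"
  where "double_coset N N0 x = (N0 #>\<^bsub>N\<^esub> x) <#>\<^bsub>N\<^esub> N0"

text \<open>\<open>[x]\<close>, the characteristic function of \<open>N0 x N0\<close>.\<close>

definition hecke_char :: "('a, 'm) monoid_scheme \<Rightarrow> 'a set \<Rightarrow> 'a \<Rightarrow> 'a \<Rightarrow> complex"
  where "hecke_char N N0 x = indicator (double_coset N N0 x)"

text \<open>Functions on \<open>N\<close> are represented by functions on the whole type that vanish outside
  \<open>carrier N\<close>, so that equality on the carrier is equality.\<close>

definition hecke_space :: "('a, 'm) monoid_scheme \<Rightarrow> 'a set \<Rightarrow> ('a \<Rightarrow> complex) set"
  where "hecke_space N N0 = {f.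
    (\<forall>x. x \<notin> carrier N \<longrightarrow> f x = 0) \<and>
    (\<forall>x\<in>carrier N. \<forall>m\<in>N0. \<forall>n\<in>N0. f (m \<otimes>\<^bsub>N\<^esub> x \<otimes>\<^bsub>N\<^esub> n) = f x) \<and>
    finite {double_coset N N0 x |x. x \<in> carrier N \<and> f x \<noteq> 0}}"

text \<open>\<open>(f1 * f2)(x) = \<Sum>\<^bsub>y \<in> N0 \<setminus> N\<^esub> f1(x y\<^sup>-\<^sup>1) f2(y)\<close>. For biinvariant \<open>f1\<close>, \<open>f2\<close> the summand does not
  depend on the representative \<open>y\<close> of the coset. The index set is cut down to the cosets
  with nonzero summand because HOL's \<open>sum\<close> over an infinite set is \<open>0\<close>; for a Hecke pair
  and \<open>f1\<close>, \<open>f2\<close> in the Hecke space the remaining index set is finite.\<close>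

definition hecke_mult ::
  "('a, 'm) monoid_scheme \<Rightarrow> 'a set \<Rightarrow> ('a \<Rightarrow> complex) \<Rightarrow> ('a \<Rightarrow> complex) \<Rightarrow> 'a \<Rightarrow> complex"
  where "hecke_mult N N0 f1 f2 x =
    (if x \<in> carrier N then
       let summand = (\<lambda>C. let y = (SOME y. y \<in> C) in f1 (x \<otimes>\<^bsub>N\<^esub> inv\<^bsub>N\<^esub> y) * f2 y)
       in \<Sum>C\<in>{C \<in> rcosets\<^bsub>N\<^esub> N0. summand C \<noteq> 0}. summand C
     else 0)"

definition hecke_algebra ::
  "('a, 'm) monoid_scheme \<Rightarrow> 'a set \<Rightarrow> (complex, 'a \<Rightarrow> complex) module"
  where "hecke_algebra N N0 =
    \<lparr>carrier = hecke_space N N0,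
     monoid.mult = hecke_mult N N0,
     one = indicator N0,
     ring.zero = (\<lambda>_. 0),
     add = (\<lambda>f1 f2 x. f1 x + f2 x),
     smult = (\<lambda>c f x. c * f x)\<rparr>"

text \<open>\<open>\<H>(S, N0)\<close>, as a subalgebra of \<open>\<H>(N, N0)\<close>; meant for subsemigroups \<open>S\<close> of \<open>N\<close> containing \<open>N0\<close>.\<close>

definition hecke_subalgebra ::
  "('a, 'm) monoid_scheme \<Rightarrow> 'a set \<Rightarrow> 'a set \<Rightarrow> (complex, 'a \<Rightarrow> complex) module"
  where "hecke_subalgebra N S N0 = (hecke_algebra N N0)
    \<lparr>carrier := {f \<in> hecke_space N N0. \<forall>x. f x \<noteq> 0 \<longrightarrow> (\<exists>s\<in>S. x \<in> double_coset N N0 s)}\<rparr>"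

text \<open>Homomorphisms of unital complex algebras. The locale \<open>algebra\<close> of the library is not used since it
  requires a commutative multiplication.\<close>

definition alg_hom ::
  "(complex, 'a) module \<Rightarrow> (complex, 'b) module \<Rightarrow> ('a \<Rightarrow> 'b) set"
  where "alg_hom A B = {\<phi> \<in> ring_hom A B.
    \<forall>c. \<forall>f\<in>carrier A. \<phi> (c \<odot>\<^bsub>A\<^esub> f) = c \<odot>\<^bsub>B\<^esub> \<phi> f}"

end

theory Submission
  imports Defs
begin

text \<open>Write \<open>N = V \<rtimes> G\<close> and \<open>N0 = V0 \<rtimes> \<Gamma>\<close>. For \<open>s \<in> S\<close> the group \<open>s(V0)\<close> contains \<open>V0\<close>, and it absorbs all
  contributions of \<open>V0\<close> from both sides: multiplying out \<open>N0 (1, s) N0\<close> gives exactly the pairs \<open>(w, h)\<close>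
  with \<open>h \<in> \<Gamma>s\<Gamma>\<close> and \<open>w \<in> h(V0)\<close> (\<open>double_coset_semidirect\<close>). Hence the linear extension of
  \<open>[s] \<mapsto> [(1, s)]\<close> has the closed form \<open>\<iota> f (v, g) = f g\<close> if \<open>v \<in> g(V0)\<close>, and \<open>0\<close> otherwise. In this form
  linearity and the unit are immediate, and \<open>\<iota>\<close> is injective because \<open>f g = \<iota> f (1, g)\<close>.

  The point is multiplicativity. Fix \<open>(v, g)\<close> and a coset of \<open>N0\<close> with representative \<open>(w, h)\<close>, and put
  \<open>k = g h\<^sup>-\<^sup>1\<close>. The first factor of the summand is evaluated at \<open>(k(k\<^sup>-\<^sup>1(v) w\<^sup>-\<^sup>1), k)\<close>, so it vanishes unless
  \<open>w \<in> V0 k\<^sup>-\<^sup>1(v)\<close>; given this, the condition \<open>w \<in> h(V0)\<close> from the second factor says the same as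
  \<open>v \<in> kh(V0) = g(V0)\<close> (\<open>lift_product\<close>). Thus for \<open>v \<notin> g(V0)\<close> the whole product vanishes at \<open>(v, g)\<close>, while for
  \<open>v \<in> g(V0)\<close> each coset \<open>\<Gamma>h\<close> that contributes to the product in \<open>\<H>(G, \<Gamma>)\<close> lies below exactly one
  contributing coset of \<open>N0\<close>, with the same summand. The two sums therefore agree term by term
  (\<open>lift_mult\<close>).\<close>

section \<open>Hecke products as sums over cosets\<close>

definition hecke_summand ::
  "('a, 'm) monoid_scheme \<Rightarrow> ('a \<Rightarrow> complex) \<Rightarrow> ('a \<Rightarrow> complex) \<Rightarrow> 'a \<Rightarrow> 'a set \<Rightarrow> complex"
  where "hecke_summand N f1 f2 x C =
    (let y = (SOME y. y \<in> C) in f1 (x \<otimes>\<^bsub>N\<^esub> inv\<^bsub>N\<^esub> y) * f2 y)"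

lemma hecke_mult_eq_sum:
  assumes "x \<in> carrier N"
  shows "hecke_mult N H f1 f2 x =
    (\<Sum>C\<in>{C \<in> rcosets\<^bsub>N\<^esub> H. hecke_summand N f1 f2 x C \<noteq> 0}. hecke_summand N f1 f2 x C)"
  using assms by (simp add: hecke_mult_def hecke_summand_def Let_def)

lemma hecke_space_biinvariant:
  assumes "f \<in> hecke_space N H" "x \<in> carrier N" "m \<in> H" "n \<in> H"
  shows "f (m \<otimes>\<^bsub>N\<^esub> x \<otimes>\<^bsub>N\<^esub> n) = f x"
  using assms by (simp add: hecke_space_def)

text \<open>Left invariance of \<open>f2\<close> and right invariance of \<open>f1\<close> make the summand independent of the representative
  picked by \<open>SOME\<close>.\<close>

lemma (in group) hecke_summand_rcos:
  assumes H: "subgroup H G"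
    and f1: "f1 \<in> hecke_space G H" and f2: "f2 \<in> hecke_space G H"
    and x: "x \<in> carrier G" and y: "y \<in> carrier G"
  shows "hecke_summand G f1 f2 x (H #> y) = f1 (x \<otimes> inv y) * f2 y"
proof -
  interpret H: subgroup H G by (fact H)
  define z where "z = (SOME z. z \<in> H #> y)"
  have "z \<in> H #> y"
    unfolding z_def using rcos_self[OF y H] by (rule someI)
  then obtain n where n: "n \<in> H" and z: "z = n \<otimes> y"
    by (auto simp: r_coset_def)
  have "x \<otimes> inv z = \<one> \<otimes> (x \<otimes> inv y) \<otimes> inv n"
    using n x y by (simp add: z inv_mult_group m_assoc)
  then have "f1 (x \<otimes> inv z) = f1 (x \<otimes> inv y)"
    using hecke_space_biinvariant[OF f1, of "x \<otimes> inv y" \<one> "inv n"] n x y by simp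
  moreover have "f2 z = f2 y"
    using hecke_space_biinvariant[OF f2, of y n \<one>] n y by (simp add: z)
  ultimately show ?thesis
    by (simp add: hecke_summand_def flip: z_def)
qed

lemma mem_double_coset_iff:
  "x \<in> double_coset N H s \<longleftrightarrow> (\<exists>m\<in>H. \<exists>n\<in>H. x = m \<otimes>\<^bsub>N\<^esub> s \<otimes>\<^bsub>N\<^esub> n)"
  by (auto simp: double_coset_def r_coset_def set_mult_def)

lemma mem_hecke_subalgebra_iff:
  "f \<in> carrier (hecke_subalgebra N T H) \<longleftrightarrow>
    f \<in> hecke_space N H \<and> (\<forall>x. f x \<noteq> 0 \<longrightarrow> (\<exists>s\<in>T. x \<in> double_coset N H s))"
  by (simp add: hecke_subalgebra_def hecke_algebra_def)

section \<open>The action and its expanding elements\<close>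

locale hecke_semidirect =
  V: group V + G: group G + act: group_hom G "AutoGroup V" \<alpha> +
  V0: subgroup V0 V + \<Gamma>: subgroup \<Gamma> G
  for V :: "('v, 'm) monoid_scheme" (structure) and G :: "('g, 'n) monoid_scheme" (structure)
    and \<alpha> :: "'g \<Rightarrow> 'v \<Rightarrow> 'v" and V0 :: "'v set" and \<Gamma> :: "'g set" +
  assumes invariant: "\<And>g. g \<in> \<Gamma> \<Longrightarrow> \<alpha> g ` V0 \<subseteq> V0"
    and pair: "hecke_pair (semidirect V G \<alpha>) (V0 \<times> \<Gamma>)"
begin

abbreviation N where "N \<equiv> semidirect V G \<alpha>"
abbreviation N0 where "N0 \<equiv> V0 \<times> \<Gamma>"

definition S where "S = {s \<in> carrier G. V0 \<subseteq> \<alpha> s ` V0}"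

sublocale N: group N
  using pair by (simp add: hecke_pair_def)

sublocale N0: subgroup N0 N
  using pair by (simp add: hecke_pair_def)

lemma carrier_N [simp]: "carrier N = carrier V \<times> carrier G"
  and mult_N [simp]: "(v, g) \<otimes>\<^bsub>N\<^esub> (w, h) = (v \<otimes>\<^bsub>V\<^esub> \<alpha> g w, g \<otimes>\<^bsub>G\<^esub> h)"
  and one_N [simp]: "\<one>\<^bsub>N\<^esub> = (\<one>\<^bsub>V\<^esub>, \<one>\<^bsub>G\<^esub>)"
  by (simp_all add: semidirect_def)

text \<open>The simplification rules for the homomorphism \<open>\<alpha>\<close> produce operations of \<open>AutoGroup V\<close>; the pointwise
  rules below take their place.\<close>

declare act.hom_mult [simp del] act.hom_one [simp del] act.hom_inv [simp del]

lemma act_auto: "g \<in> carrier G \<Longrightarrow> \<alpha> g \<in> auto V"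
  using act.hom_closed by (simp add: AutoGroup_def BijGroup_def)

lemma act_group_hom: "g \<in> carrier G \<Longrightarrow> group_hom V V (\<alpha> g)"
  using act_auto by unfold_locales (auto simp: auto_def)

lemma act_closed [simp]: "\<lbrakk>g \<in> carrier G; v \<in> carrier V\<rbrakk> \<Longrightarrow> \<alpha> g v \<in> carrier V"
  by (rule group_hom.hom_closed[OF act_group_hom])

lemma act_mult:
  "\<lbrakk>g \<in> carrier G; v \<in> carrier V; w \<in> carrier V\<rbrakk> \<Longrightarrow> \<alpha> g (v \<otimes>\<^bsub>V\<^esub> w) = \<alpha> g v \<otimes>\<^bsub>V\<^esub> \<alpha> g w"
  by (rule group_hom.hom_mult[OF act_group_hom])

lemma act_one [simp]: "g \<in> carrier G \<Longrightarrow> \<alpha> g \<one>\<^bsub>V\<^esub> = \<one>\<^bsub>V\<^esub>"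
  by (rule group_hom.hom_one[OF act_group_hom])

lemma act_inv: "\<lbrakk>g \<in> carrier G; v \<in> carrier V\<rbrakk> \<Longrightarrow> \<alpha> g (inv\<^bsub>V\<^esub> v) = inv\<^bsub>V\<^esub> (\<alpha> g v)"
  by (rule group_hom.hom_inv[OF act_group_hom])

lemma act_comp:
  assumes "g \<in> carrier G" "h \<in> carrier G" "v \<in> carrier V"
  shows "\<alpha> (g \<otimes>\<^bsub>G\<^esub> h) v = \<alpha> g (\<alpha> h v)"
proof -
  have "\<alpha> g \<in> Bij (carrier V)" "\<alpha> h \<in> Bij (carrier V)"
    using assms act_auto by (auto simp: auto_def)
  then show ?thesis
    using act.hom_mult[of g h] assms by (simp add: AutoGroup_def BijGroup_def compose_def)
qed

lemma act_unit [simp]: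
  assumes "v \<in> carrier V"
  shows "\<alpha> \<one>\<^bsub>G\<^esub> v = v"
  using act.hom_one assms by (simp add: AutoGroup_def BijGroup_def)

lemma act_inv_cancel [simp]:
  assumes "g \<in> carrier G" "v \<in> carrier V"
  shows "\<alpha> (inv\<^bsub>G\<^esub> g) (\<alpha> g v) = v" "\<alpha> g (\<alpha> (inv\<^bsub>G\<^esub> g) v) = v"
  using assms by (simp_all flip: act_comp)

lemma inv_N:
  assumes "v \<in> carrier V" "g \<in> carrier G"
  shows "inv\<^bsub>N\<^esub> (v, g) = (\<alpha> (inv\<^bsub>G\<^esub> g) (inv\<^bsub>V\<^esub> v), inv\<^bsub>G\<^esub> g)"
  using assms by (intro N.inv_equality) (simp_all flip: act_mult)

lemma subgroup_act_image: "g \<in> carrier G \<Longrightarrow> subgroup (\<alpha> g ` V0) V"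
  by (intro group_hom.subgroup_img_is_subgroup[OF act_group_hom] V0.subgroup_axioms)

lemma act_image_comp:
  assumes "g \<in> carrier G" "h \<in> carrier G" "A \<subseteq> carrier V"
  shows "\<alpha> (g \<otimes>\<^bsub>G\<^esub> h) ` A = \<alpha> g ` \<alpha> h ` A"
  unfolding image_image using assms by (intro image_cong refl act_comp) auto

lemma act_mem_image_iff:
  assumes "g \<in> carrier G" "v \<in> carrier V" "A \<subseteq> carrier V"
  shows "\<alpha> g v \<in> \<alpha> g ` A \<longleftrightarrow> v \<in> A"
proof
  assume "\<alpha> g v \<in> \<alpha> g ` A"
  then obtain a where a: "a \<in> A" "\<alpha> g v = \<alpha> g a" by blast
  have "v = \<alpha> (inv\<^bsub>G\<^esub> g) (\<alpha> g a)"
    using assms by (simp flip: a(2))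
  also have "\<dots> = a"
    using a assms by (intro act_inv_cancel) auto
  finally show "v \<in> A"
    using a by simp
qed simp

text \<open>Invariance under \<open>g\<^sup>-\<^sup>1 \<in> \<Gamma>\<close> upgrades the inclusion to an equality.\<close>

lemma \<Gamma>_image:
  assumes "g \<in> \<Gamma>"
  shows "\<alpha> g ` V0 = V0"
proof -
  have "\<alpha> g ` \<alpha> (inv\<^bsub>G\<^esub> g) ` V0 = \<alpha> \<one>\<^bsub>G\<^esub> ` V0"
    using assms by (simp add: V0.subset flip: act_image_comp)
  also have "\<dots> = id ` V0"
    by (intro image_cong) simp_all
  finally have "V0 = \<alpha> g ` \<alpha> (inv\<^bsub>G\<^esub> g) ` V0"
    by simp
  also have "\<dots> \<subseteq> \<alpha> g ` V0"
    using assms by (intro image_mono invariant) simp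
  finally show ?thesis
    using invariant[OF assms] by blast
qed

lemma \<Gamma>_subset_S: "\<Gamma> \<subseteq> S"
  by (auto simp: S_def \<Gamma>_image)

lemma S_expanding: "s \<in> S \<Longrightarrow> V0 \<subseteq> \<alpha> s ` V0"
  by (simp add: S_def)

lemma S_carrier [simp]: "s \<in> S \<Longrightarrow> s \<in> carrier G"
  by (simp add: S_def)

lemma S_mult:
  assumes "s \<in> S" "t \<in> S"
  shows "s \<otimes>\<^bsub>G\<^esub> t \<in> S"
proof -
  have "V0 \<subseteq> \<alpha> s ` V0"
    using assms by (intro S_expanding)
  also have "\<dots> \<subseteq> \<alpha> s ` \<alpha> t ` V0"
    using assms by (intro image_mono S_expanding)
  also have "\<dots> = \<alpha> (s \<otimes>\<^bsub>G\<^esub> t) ` V0"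
    using assms by (simp add: act_image_comp V0.subset)
  finally show ?thesis
    using assms unfolding S_def by blast
qed

lemma subsemigroup_S: "subsemigroup S G"
  by (auto simp: subsemigroup_def S_mult)

lemma double_coset_subset_S:
  assumes "s \<in> S" "x \<in> double_coset G \<Gamma> s"
  shows "x \<in> S"
  using assms by (auto simp: mem_double_coset_iff S_mult subsetD[OF \<Gamma>_subset_S])

section \<open>Double cosets in the semidirect product\<close>

text \<open>For \<open>u, w \<in> V0\<close> and \<open>\<gamma>, \<delta> \<in> \<Gamma>\<close> this concerns the product \<open>(u, \<gamma>)(v, g)(w, \<delta>)\<close> in \<open>N\<close>, and it
  makes the condition \<open>v \<in> g(V0)\<close> on a pair \<open>(v, g)\<close> biinvariant under \<open>N0\<close>. Since \<open>\<delta>\<close> fixes \<open>V0\<close>, the group on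
  the left is \<open>K = \<gamma>g(V0)\<close>. It contains \<open>\<gamma>g(w)\<close> trivially and \<open>u\<close> because \<open>\<gamma>g \<in> S\<close>, so both outer
  factors can be cancelled.\<close>

lemma mem_translate_iff:
  assumes g: "g \<in> S" and v: "v \<in> carrier V"
    and u: "u \<in> V0" and \<gamma>: "\<gamma> \<in> \<Gamma>" and w: "w \<in> V0" and \<delta>: "\<delta> \<in> \<Gamma>"
  shows "u \<otimes>\<^bsub>V\<^esub> \<alpha> \<gamma> v \<otimes>\<^bsub>V\<^esub> \<alpha> (\<gamma> \<otimes>\<^bsub>G\<^esub> g) w \<in> \<alpha> (\<gamma> \<otimes>\<^bsub>G\<^esub> g \<otimes>\<^bsub>G\<^esub> \<delta>) ` V0 \<longleftrightarrow> v \<in> \<alpha> g ` V0"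
proof -
  have \<gamma>g: "\<gamma> \<otimes>\<^bsub>G\<^esub> g \<in> S"
    using g \<gamma> \<Gamma>_subset_S S_mult by blast
  define K where "K = \<alpha> (\<gamma> \<otimes>\<^bsub>G\<^esub> g) ` V0"
  interpret K: subgroup K V
    unfolding K_def using \<gamma>g by (intro subgroup_act_image) simp
  have K: "\<alpha> (\<gamma> \<otimes>\<^bsub>G\<^esub> g \<otimes>\<^bsub>G\<^esub> \<delta>) ` V0 = K"
    using g \<gamma> \<delta> by (simp add: K_def act_image_comp[of _ \<delta>] V0.subset \<Gamma>_image)
  have uK: "u \<in> K"
    using S_expanding[OF \<gamma>g] u by (auto simp: K_def)
  have wK: "\<alpha> (\<gamma> \<otimes>\<^bsub>G\<^esub> g) w \<in> K"
    using w by (simp add: K_def)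
  have \<gamma>v: "\<alpha> \<gamma> v \<in> carrier V"
    using \<gamma> v by simp
  have "u \<otimes>\<^bsub>V\<^esub> \<alpha> \<gamma> v \<otimes>\<^bsub>V\<^esub> \<alpha> (\<gamma> \<otimes>\<^bsub>G\<^esub> g) w \<in> K \<longleftrightarrow> \<alpha> \<gamma> v \<in> K"
    (is "?p \<in> K \<longleftrightarrow> _")
  proof
    assume "?p \<in> K"
    then have "inv\<^bsub>V\<^esub> u \<otimes>\<^bsub>V\<^esub> ?p \<otimes>\<^bsub>V\<^esub> inv\<^bsub>V\<^esub> (\<alpha> (\<gamma> \<otimes>\<^bsub>G\<^esub> g) w) \<in> K"
      using uK wK by simp
    moreover have "inv\<^bsub>V\<^esub> u \<otimes>\<^bsub>V\<^esub> ?p \<otimes>\<^bsub>V\<^esub> inv\<^bsub>V\<^esub> (\<alpha> (\<gamma> \<otimes>\<^bsub>G\<^esub> g) w) = \<alpha> \<gamma> v"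
      using uK wK \<gamma>v
      by (simp add: V.m_assoc K.mem_carrier) (simp add: K.mem_carrier flip: V.m_assoc)
    ultimately show "\<alpha> \<gamma> v \<in> K" by simp
  qed (use uK wK in simp)
  also have "K = \<alpha> \<gamma> ` \<alpha> g ` V0"
    using g \<gamma> by (simp add: K_def act_image_comp V0.subset)
  also have "\<alpha> \<gamma> v \<in> \<alpha> \<gamma> ` \<alpha> g ` V0 \<longleftrightarrow> v \<in> \<alpha> g ` V0"
    using g \<gamma> v subgroup.subset[OF subgroup_act_image[of g]] by (simp add: act_mem_image_iff)
  finally show ?thesis by (simp add: K \<open>K = \<alpha> \<gamma> ` \<alpha> g ` V0\<close>)
qed

text \<open>One inclusion is \<open>mem_translate_iff\<close>. For the other, every \<open>w = h(w0)\<close> with \<open>h = \<gamma>g\<delta>\<close> is reached by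
  right multiplication alone in the \<open>V\<close> component, since \<open>h(w0) = \<gamma>g(\<delta>(w0))\<close>. In particular the double coset
  depends only on \<open>\<Gamma>g\<Gamma>\<close>.\<close>

lemma double_coset_semidirect:
  assumes g: "g \<in> S" and v: "v \<in> \<alpha> g ` V0"
  shows "double_coset N N0 (v, g) = {(w, h). h \<in> double_coset G \<Gamma> g \<and> w \<in> \<alpha> h ` V0}"
proof (intro subset_antisym subrelI)
  have vV: "v \<in> carrier V"
    using v g by auto
  fix w h
  show "(w, h) \<in> {(w, h). h \<in> double_coset G \<Gamma> g \<and> w \<in> \<alpha> h ` V0}"
    if "(w, h) \<in> double_coset N N0 (v, g)"
  proof -
    from that obtain u \<gamma> u' \<delta> where "u \<in> V0" "\<gamma> \<in> \<Gamma>" "u' \<in> V0" "\<delta> \<in> \<Gamma>"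
      and "w = u \<otimes>\<^bsub>V\<^esub> \<alpha> \<gamma> v \<otimes>\<^bsub>V\<^esub> \<alpha> (\<gamma> \<otimes>\<^bsub>G\<^esub> g) u'" "h = \<gamma> \<otimes>\<^bsub>G\<^esub> g \<otimes>\<^bsub>G\<^esub> \<delta>"
      by (auto simp: mem_double_coset_iff)
    then show ?thesis
      using mem_translate_iff[OF g vV] v by (auto simp: mem_double_coset_iff)
  qed
  show "(w, h) \<in> double_coset N N0 (v, g)"
    if "(w, h) \<in> {(w, h). h \<in> double_coset G \<Gamma> g \<and> w \<in> \<alpha> h ` V0}"
  proof -
    from that obtain \<gamma> \<delta> w0 where \<gamma>: "\<gamma> \<in> \<Gamma>" and \<delta>: "\<delta> \<in> \<Gamma>" and w0: "w0 \<in> V0"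
      and h: "h = \<gamma> \<otimes>\<^bsub>G\<^esub> g \<otimes>\<^bsub>G\<^esub> \<delta>" and w: "w = \<alpha> h w0"
      by (auto simp: mem_double_coset_iff)
    from v obtain v0 where v0: "v0 \<in> V0" "v = \<alpha> g v0" by blast
    have \<delta>w0: "\<alpha> \<delta> w0 \<in> V0"
      using invariant[OF \<delta>] w0 by blast
    \<comment> \<open>The factor \<open>v0\<^sup>-\<^sup>1\<close> removes \<open>v = g(v0)\<close>, so that \<open>\<delta>(w0)\<close> alone is left inside \<open>\<gamma>g\<close>.\<close>
    let ?n = "(inv\<^bsub>V\<^esub> v0 \<otimes>\<^bsub>V\<^esub> \<alpha> \<delta> w0, \<delta>)"
    have "(w, h) = (\<one>\<^bsub>V\<^esub>, \<gamma>) \<otimes>\<^bsub>N\<^esub> (v, g) \<otimes>\<^bsub>N\<^esub> ?n"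
      using \<gamma> \<delta> w0 v0 g \<delta>w0 V0.mem_carrier
      by (simp add: h w act_comp act_mult act_inv flip: V.m_assoc)
    moreover have "(\<one>\<^bsub>V\<^esub>, \<gamma>) \<in> N0" "?n \<in> N0"
      using \<gamma> \<delta> v0 \<delta>w0 by auto
    ultimately show ?thesis
      unfolding mem_double_coset_iff by blast
  qed
qed

section \<open>The embedding of Hecke algebras\<close>

text \<open>The map \<open>\<iota>\<close>. A formula for all functions spares an expansion of \<open>f\<close> in characteristic functions;
  \<open>lift_hecke_char\<close> identifies it on these.\<close>

definition lift :: "('g \<Rightarrow> complex) \<Rightarrow> 'v \<times> 'g \<Rightarrow> complex"
  where "lift f = (\<lambda>(v, g). if v \<in> \<alpha> g ` V0 then f g else 0)"

lemma lift_hecke_char: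
  assumes "s \<in> S"
  shows "lift (hecke_char G \<Gamma> s) = hecke_char N N0 (\<one>\<^bsub>V\<^esub>, s)"
proof -
  have "\<one>\<^bsub>V\<^esub> \<in> \<alpha> s ` V0"
    using assms by (simp add: subgroup.one_closed[OF subgroup_act_image])
  then show ?thesis
    using assms by (auto simp: lift_def hecke_char_def double_coset_semidirect indicator_def)
qed

lemma support_in_S:
  assumes "f \<in> carrier (hecke_subalgebra G S \<Gamma>)" "f g \<noteq> 0"
  shows "g \<in> S"
proof -
  obtain s where "s \<in> S" "g \<in> double_coset G \<Gamma> s"
    using assms unfolding mem_hecke_subalgebra_iff by blast
  then show ?thesis
    by (rule double_coset_subset_S)
qed

text \<open>Finiteness of the support modulo \<open>N0\<close> is inherited from \<open>f\<close> because the double coset of a pair \<open>(v, g)\<close>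
  in the support is determined by \<open>\<Gamma>g\<Gamma>\<close>.\<close>

lemma lift_closed:
  assumes f: "f \<in> carrier (hecke_subalgebra G S \<Gamma>)"
  shows "lift f \<in> hecke_space N N0"
proof -
  have fG: "f \<in> hecke_space G \<Gamma>"
    using f by (simp add: mem_hecke_subalgebra_iff)
  have "x \<in> carrier N" if "lift f x \<noteq> 0" for x
  proof (cases x)
    case (Pair v g)
    then have "f g \<noteq> 0" and v: "v \<in> \<alpha> g ` V0"
      using that by (auto simp: lift_def split: if_splits)
    then have "g \<in> S"
      using support_in_S[OF f] by blast
    with v Pair show ?thesis by auto
  qed
  then have "lift f x = 0" if "x \<notin> carrier N" for x
    using that by blast
  moreover have "lift f (m \<otimes>\<^bsub>N\<^esub> x \<otimes>\<^bsub>N\<^esub> n) = lift f x"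
    if "x \<in> carrier N" "m \<in> N0" "n \<in> N0" for x m n
  proof -
    obtain v g u \<gamma> w \<delta> where eqs: "x = (v, g)" "m = (u, \<gamma>)" "n = (w, \<delta>)"
      by (metis surj_pair)
    have "f (\<gamma> \<otimes>\<^bsub>G\<^esub> g \<otimes>\<^bsub>G\<^esub> \<delta>) = f g"
      using that by (intro hecke_space_biinvariant[OF fG]) (auto simp: eqs)
    then show ?thesis
      using that mem_translate_iff[of g v u \<gamma> w \<delta>] support_in_S[OF f, of g]
      by (auto simp: lift_def eqs)
  qed
  moreover have "finite {double_coset N N0 x |x. x \<in> carrier N \<and> lift f x \<noteq> 0}"
  proof (rule finite_surj)
    show "finite {double_coset G \<Gamma> g |g. g \<in> carrier G \<and> f g \<noteq> 0}"
      using fG by (simp add: hecke_space_def)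
    show "{double_coset N N0 x |x. x \<in> carrier N \<and> lift f x \<noteq> 0} \<subseteq>
      (\<lambda>D. {(w, h). h \<in> D \<and> w \<in> \<alpha> h ` V0}) ` {double_coset G \<Gamma> g |g. g \<in> carrier G \<and> f g \<noteq> 0}"
    proof clarify
      fix v g assume "(v, g) \<in> carrier N" and "lift f (v, g) \<noteq> 0"
      then have g: "f g \<noteq> 0" "v \<in> \<alpha> g ` V0"
        by (auto simp: lift_def split: if_splits)
      then have "g \<in> S" using support_in_S[OF f] by blast
      with g show "double_coset N N0 (v, g) \<in> (\<lambda>D. {(w, h). h \<in> D \<and> w \<in> \<alpha> h ` V0}) `
        {double_coset G \<Gamma> g |g. g \<in> carrier G \<and> f g \<noteq> 0}"
        by (intro image_eqI[of _ _ "double_coset G \<Gamma> g"])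
          (simp_all add: double_coset_semidirect, use \<open>g \<in> S\<close> S_carrier in blast)
    qed
  qed
  ultimately show ?thesis
    unfolding hecke_space_def by blast
qed

lemma lift_one: "lift (indicator \<Gamma>) = indicator N0"
proof (rule ext, clarify)
  fix v g
  show "lift (indicator \<Gamma>) (v, g) = indicator N0 (v, g)"
    by (cases "g \<in> \<Gamma>") (simp_all add: lift_def indicator_def \<Gamma>_image)
qed

lemma lift_inj_on: "inj_on lift (carrier (hecke_subalgebra G S \<Gamma>))"
proof (rule inj_onI, rule ext)
  fix f1 f2 g
  assume f: "f1 \<in> carrier (hecke_subalgebra G S \<Gamma>)" "f2 \<in> carrier (hecke_subalgebra G S \<Gamma>)"
    and eq: "lift f1 = lift f2"
  show "f1 g = f2 g"
  proof (cases "g \<in> S")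
    case True
    then have "\<one>\<^bsub>V\<^esub> \<in> \<alpha> g ` V0"
      by (simp add: subgroup.one_closed[OF subgroup_act_image])
    then show ?thesis
      using fun_cong[OF eq, of "(\<one>\<^bsub>V\<^esub>, g)"] by (simp add: lift_def)
  next
    case False
    then show ?thesis using support_in_S f by metis
  qed
qed

lemma snd_rcos: "snd ` (N0 #>\<^bsub>N\<^esub> (w, h)) = \<Gamma> #>\<^bsub>G\<^esub> h"
proof (intro subset_antisym subsetI)
  fix x assume "x \<in> snd ` (N0 #>\<^bsub>N\<^esub> (w, h))"
  then obtain \<gamma> where "\<gamma> \<in> \<Gamma>" "x = \<gamma> \<otimes>\<^bsub>G\<^esub> h"
    by (auto simp: r_coset_def)
  then show "x \<in> \<Gamma> #>\<^bsub>G\<^esub> h"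
    by (auto simp: r_coset_def)
next
  fix x assume "x \<in> \<Gamma> #>\<^bsub>G\<^esub> h"
  then obtain \<gamma> where "\<gamma> \<in> \<Gamma>" "x = \<gamma> \<otimes>\<^bsub>G\<^esub> h"
    by (auto simp: r_coset_def)
  then have "(\<one>\<^bsub>V\<^esub> \<otimes>\<^bsub>V\<^esub> \<alpha> \<gamma> w, x) \<in> N0 #>\<^bsub>N\<^esub> (w, h)"
    unfolding r_coset_def by (intro UN_I[of "(\<one>\<^bsub>V\<^esub>, \<gamma>)"]) simp_all
  then show "x \<in> snd ` (N0 #>\<^bsub>N\<^esub> (w, h))"
    by (rule image_eqI[rotated]) simp
qed

text \<open>The summand of the product of two lifted functions. The condition \<open>w \<in> V0 k\<^sup>-\<^sup>1(v)\<close> singles out one coset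
  of \<open>V0\<close>, which is the reason why no multiplicities appear in \<open>lift_mult\<close>. On this coset the remaining
  condition \<open>w \<in> h(V0)\<close> can be read at the representative \<open>k\<^sup>-\<^sup>1(v)\<close>, because \<open>V0 \<subseteq> h(V0)\<close>; there it
  becomes \<open>v \<in> g(V0)\<close>.\<close>

lemma lift_product:
  assumes f: "f1 \<in> carrier (hecke_subalgebra G S \<Gamma>)" "f2 \<in> carrier (hecke_subalgebra G S \<Gamma>)"
    and v: "v \<in> carrier V" and g: "g \<in> carrier G" and w: "w \<in> carrier V" and h: "h \<in> carrier G"
  defines "k \<equiv> g \<otimes>\<^bsub>G\<^esub> inv\<^bsub>G\<^esub> h"
  shows "lift f1 ((v, g) \<otimes>\<^bsub>N\<^esub> inv\<^bsub>N\<^esub> (w, h)) * lift f2 (w, h) =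
    (if v \<in> \<alpha> g ` V0 \<and> w \<in> V0 #>\<^bsub>V\<^esub> \<alpha> (inv\<^bsub>G\<^esub> k) v then f1 k * f2 h else 0)"
proof (cases "f1 k = 0 \<or> f2 h = 0")
  case True
  then show ?thesis using v g w h by (auto simp: lift_def inv_N k_def)
next
  case False
  then have hS: "h \<in> S" and kS: "k \<in> S" using support_in_S f by blast+
  define x where "x = \<alpha> (inv\<^bsub>G\<^esub> k) v"
  have k: "k \<in> carrier G" and x: "x \<in> carrier V" and vx: "v = \<alpha> k x" and gkh: "g = k \<otimes>\<^bsub>G\<^esub> h"
    using g h v by (simp_all add: k_def x_def G.m_assoc)
  have "(v, g) \<otimes>\<^bsub>N\<^esub> inv\<^bsub>N\<^esub> (w, h) = (\<alpha> k (x \<otimes>\<^bsub>V\<^esub> inv\<^bsub>V\<^esub> w), k)"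
  proof -
    have "\<alpha> g (\<alpha> (inv\<^bsub>G\<^esub> h) (inv\<^bsub>V\<^esub> w)) = \<alpha> k (inv\<^bsub>V\<^esub> w)"
      using g h w by (simp add: k_def act_comp)
    then show ?thesis
      using k x w g h v by (simp add: inv_N act_mult flip: vx k_def)
  qed
  moreover have "\<alpha> k (x \<otimes>\<^bsub>V\<^esub> inv\<^bsub>V\<^esub> w) \<in> \<alpha> k ` V0 \<longleftrightarrow> x \<otimes>\<^bsub>V\<^esub> inv\<^bsub>V\<^esub> w \<in> V0"
    using k x w by (simp add: act_mem_image_iff V0.subset)
  moreover have "x \<otimes>\<^bsub>V\<^esub> inv\<^bsub>V\<^esub> w \<in> V0 \<longleftrightarrow> w \<in> V0 #>\<^bsub>V\<^esub> x"
  proof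
    assume "x \<otimes>\<^bsub>V\<^esub> inv\<^bsub>V\<^esub> w \<in> V0"
    then have "inv\<^bsub>V\<^esub> (x \<otimes>\<^bsub>V\<^esub> inv\<^bsub>V\<^esub> w) \<in> V0" by simp
    moreover have "inv\<^bsub>V\<^esub> (x \<otimes>\<^bsub>V\<^esub> inv\<^bsub>V\<^esub> w) \<otimes>\<^bsub>V\<^esub> x = w"
      using x w by (simp add: V.inv_mult_group V.m_assoc)
    ultimately show "w \<in> V0 #>\<^bsub>V\<^esub> x"
      unfolding r_coset_def by force
  next
    assume "w \<in> V0 #>\<^bsub>V\<^esub> x"
    then obtain u where u: "u \<in> V0" "w = u \<otimes>\<^bsub>V\<^esub> x" by (auto simp: r_coset_def)
    then have "x \<otimes>\<^bsub>V\<^esub> inv\<^bsub>V\<^esub> w = inv\<^bsub>V\<^esub> u"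
      using x by (simp add: V.inv_mult_group flip: V.m_assoc)
    with u show "x \<otimes>\<^bsub>V\<^esub> inv\<^bsub>V\<^esub> w \<in> V0" by simp
  qed
  moreover have "w \<in> \<alpha> h ` V0 \<longleftrightarrow> v \<in> \<alpha> g ` V0" if "w \<in> V0 #>\<^bsub>V\<^esub> x"
  proof -
    interpret K: subgroup "\<alpha> h ` V0" V
      using h by (rule subgroup_act_image)
    from that obtain u where u: "u \<in> V0" "w = u \<otimes>\<^bsub>V\<^esub> x" by (auto simp: r_coset_def)
    then have uK: "u \<in> \<alpha> h ` V0" using S_expanding[OF hS] by blast
    have "x = inv\<^bsub>V\<^esub> u \<otimes>\<^bsub>V\<^esub> w"
      using u x by (simp flip: V.m_assoc)
    then have "w \<in> \<alpha> h ` V0 \<longleftrightarrow> x \<in> \<alpha> h ` V0"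
      using u uK K.m_closed K.m_inv_closed by metis
    also have "\<dots> \<longleftrightarrow> v \<in> \<alpha> g ` V0"
      unfolding vx gkh using k x h
      by (simp add: act_image_comp V0.subset act_mem_image_iff K.subset)
    finally show ?thesis .
  qed
  ultimately show ?thesis
    by (auto simp: lift_def x_def)
qed

text \<open>If \<open>v \<in> g(V0)\<close>, projection to \<open>G\<close> is a bijection, compatible with the summands, from the contributing
  cosets of \<open>N0\<close> to those of \<open>\<Gamma>\<close>. Its inverse sends \<open>\<Gamma>h\<close> to the coset of \<open>(c h, h)\<close>, where
  \<open>c h = (g h\<^sup>-\<^sup>1)\<^sup>-\<^sup>1(v)\<close>.\<close>

lemma lift_mult:
  assumes f: "f1 \<in> carrier (hecke_subalgebra G S \<Gamma>)" "f2 \<in> carrier (hecke_subalgebra G S \<Gamma>)"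
  shows "lift (hecke_mult G \<Gamma> f1 f2) = hecke_mult N N0 (lift f1) (lift f2)"
proof (rule ext, clarify)
  fix v g
  let ?t = "hecke_summand N (lift f1) (lift f2) (v, g)" and ?t' = "hecke_summand G f1 f2 g"
  let ?X = "{C \<in> rcosets\<^bsub>N\<^esub> N0. ?t C \<noteq> 0}" and ?Y = "{D \<in> rcosets\<^bsub>G\<^esub> \<Gamma>. ?t' D \<noteq> 0}"
  have fG: "f1 \<in> hecke_space G \<Gamma>" "f2 \<in> hecke_space G \<Gamma>"
    using f by (simp_all add: mem_hecke_subalgebra_iff)
  show "lift (hecke_mult G \<Gamma> f1 f2) (v, g) = hecke_mult N N0 (lift f1) (lift f2) (v, g)"
  proof (cases "v \<in> carrier V \<and> g \<in> carrier G")
    case False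
    then show ?thesis by (auto simp: lift_def hecke_mult_def)
  next
    case True
    then have v: "v \<in> carrier V" and g: "g \<in> carrier G" by auto
    define c where "c h = \<alpha> (inv\<^bsub>G\<^esub> (g \<otimes>\<^bsub>G\<^esub> inv\<^bsub>G\<^esub> h)) v" for h
    have c: "c h \<in> carrier V" if "h \<in> carrier G" for h
      using that v g by (simp add: c_def)
    have t': "?t' (\<Gamma> #>\<^bsub>G\<^esub> h) = f1 (g \<otimes>\<^bsub>G\<^esub> inv\<^bsub>G\<^esub> h) * f2 h" if "h \<in> carrier G" for h
      using that g by (intro G.hecke_summand_rcos fG \<Gamma>.subgroup_axioms)
    have t: "?t (N0 #>\<^bsub>N\<^esub> (w, h)) =
      (if v \<in> \<alpha> g ` V0 \<and> w \<in> V0 #>\<^bsub>V\<^esub> c h then ?t' (\<Gamma> #>\<^bsub>G\<^esub> h) else 0)"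
      if "w \<in> carrier V" "h \<in> carrier G" for w h
      using that v g lift_product[OF f v g that]
      by (subst N.hecke_summand_rcos) (simp_all add: N0.subgroup_axioms lift_closed f t' c_def)
    show ?thesis
    proof (cases "v \<in> \<alpha> g ` V0")
      case False
      then have "?X = {}"
        by (auto simp: RCOSETS_def t)
      with False v g show ?thesis
        by (simp add: lift_def hecke_mult_eq_sum)
    next
      case True
      \<comment> \<open>A nonzero summand forces \<open>w \<in> V0 c h\<close>, so the representative can be moved to \<open>(c h, h)\<close>.\<close>
      have coset: "\<exists>h\<in>carrier G. C = N0 #>\<^bsub>N\<^esub> (c h, h) \<and> snd ` C = \<Gamma> #>\<^bsub>G\<^esub> h \<and> ?t C = ?t' (snd ` C)"
        if "C \<in> ?X" for C
      proof -
        from that obtain w h where w: "w \<in> carrier V" and h: "h \<in> carrier G"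
          and C: "C = N0 #>\<^bsub>N\<^esub> (w, h)" and nz: "?t C \<noteq> 0"
          by (auto simp: RCOSETS_def)
        then have "w \<in> V0 #>\<^bsub>V\<^esub> c h"
          by (auto simp: t split: if_splits)
        then obtain u where u: "u \<in> V0" "w = u \<otimes>\<^bsub>V\<^esub> c h"
          by (auto simp: r_coset_def)
        have "(w, h) = (u, \<one>\<^bsub>G\<^esub>) \<otimes>\<^bsub>N\<^esub> (c h, h)"
          using u c h by simp
        then have "(w, h) \<in> N0 #>\<^bsub>N\<^esub> (c h, h)"
          using N.rcosI[of "(u, \<one>\<^bsub>G\<^esub>)" N0 "(c h, h)"] u c h N0.subset by simp
        then have "C = N0 #>\<^bsub>N\<^esub> (c h, h)"
          unfolding C using c h by (intro N.repr_independence[symmetric]) (simp_all add: N0.subgroup_axioms)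
        moreover have "?t C = ?t' (\<Gamma> #>\<^bsub>G\<^esub> h)"
          using nz w h by (auto simp: C t split: if_splits)
        moreover have "snd ` C = \<Gamma> #>\<^bsub>G\<^esub> h"
          using w h by (simp add: C snd_rcos)
        ultimately show ?thesis
          using h by metis
      qed
      \<comment> \<open>The inverse map is well defined: \<open>c (\<gamma>h) = \<gamma>(c h)\<close>.\<close>
      have c_\<Gamma>: "N0 #>\<^bsub>N\<^esub> (c h, h) = N0 #>\<^bsub>N\<^esub> (c h', h')"
        if "h \<in> carrier G" "h' \<in> carrier G" "\<Gamma> #>\<^bsub>G\<^esub> h = \<Gamma> #>\<^bsub>G\<^esub> h'" for h h'
      proof -
        have "h' \<in> \<Gamma> #>\<^bsub>G\<^esub> h"
          using that G.rcos_self[OF _ \<Gamma>.subgroup_axioms] by simp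
        then obtain \<gamma> where \<gamma>: "\<gamma> \<in> \<Gamma>" "h' = \<gamma> \<otimes>\<^bsub>G\<^esub> h"
          by (auto simp: r_coset_def)
        have "inv\<^bsub>G\<^esub> (g \<otimes>\<^bsub>G\<^esub> inv\<^bsub>G\<^esub> h') = \<gamma> \<otimes>\<^bsub>G\<^esub> inv\<^bsub>G\<^esub> (g \<otimes>\<^bsub>G\<^esub> inv\<^bsub>G\<^esub> h)"
          using \<gamma> that g by (simp add: G.inv_mult_group G.m_assoc)
        then have "c h' = \<alpha> \<gamma> (c h)"
          using \<gamma> that g v by (simp add: c_def act_comp)
        then have "(c h', h') = (\<one>\<^bsub>V\<^esub>, \<gamma>) \<otimes>\<^bsub>N\<^esub> (c h, h)"
          using \<gamma> that c by simp
        then have "(c h', h') \<in> N0 #>\<^bsub>N\<^esub> (c h, h)"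
          using N.rcosI[of "(\<one>\<^bsub>V\<^esub>, \<gamma>)" N0 "(c h, h)"] \<gamma> c that N0.subset by simp
        then show ?thesis
          using c that by (intro N.repr_independence) (simp_all add: N0.subgroup_axioms)
      qed
      have bij: "bij_betw (image snd) ?X ?Y"
      proof (rule bij_betw_imageI)
        show "inj_on (image snd) ?X"
        proof (rule inj_onI)
          fix C C' assume C: "C \<in> ?X" "C' \<in> ?X" and eq: "snd ` C = snd ` C'"
          obtain h where h: "h \<in> carrier G" "C = N0 #>\<^bsub>N\<^esub> (c h, h)" "snd ` C = \<Gamma> #>\<^bsub>G\<^esub> h"
            using coset[OF C(1)] by blast
          obtain h' where h': "h' \<in> carrier G" "C' = N0 #>\<^bsub>N\<^esub> (c h', h')" "snd ` C' = \<Gamma> #>\<^bsub>G\<^esub> h'"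
            using coset[OF C(2)] by blast
          have "\<Gamma> #>\<^bsub>G\<^esub> h = \<Gamma> #>\<^bsub>G\<^esub> h'"
            using eq by (simp only: h(3) h'(3))
          then show "C = C'"
            unfolding h(2) h'(2) by (rule c_\<Gamma>[OF h(1) h'(1)])
        qed
        show "image snd ` ?X = ?Y"
        proof (intro subset_antisym subsetI)
          fix D assume "D \<in> image snd ` ?X"
          then obtain C where C: "C \<in> ?X" "D = snd ` C" by blast
          obtain h where h: "h \<in> carrier G" "snd ` C = \<Gamma> #>\<^bsub>G\<^esub> h" "?t C = ?t' (snd ` C)"
            using coset[OF C(1)] by blast
          have "?t' D \<noteq> 0"
            using C h(3) by simp
          moreover have "D \<in> rcosets\<^bsub>G\<^esub> \<Gamma>"
            unfolding C(2) h(2) using h(1) by (intro G.rcosetsI \<Gamma>.subset)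
          ultimately show "D \<in> ?Y" by simp
        next
          fix D assume D: "D \<in> ?Y"
          then obtain h where h: "h \<in> carrier G" "D = \<Gamma> #>\<^bsub>G\<^esub> h"
            by (auto simp: RCOSETS_def)
          have "c h \<in> V0 #>\<^bsub>V\<^esub> c h"
            using V.rcos_self c h V0.subgroup_axioms by blast
          then have "?t (N0 #>\<^bsub>N\<^esub> (c h, h)) = ?t' D"
            using True h c by (simp add: t)
          moreover have "N0 #>\<^bsub>N\<^esub> (c h, h) \<in> rcosets\<^bsub>N\<^esub> N0"
            using h c by (intro N.rcosetsI) (simp_all add: N0.subset[simplified])
          moreover have "snd ` (N0 #>\<^bsub>N\<^esub> (c h, h)) = D"
            using h c by (simp add: snd_rcos)
          ultimately show "D \<in> image snd ` ?X"
            using D by (intro image_eqI[of _ _ "N0 #>\<^bsub>N\<^esub> (c h, h)"]) auto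
        qed
      qed
      have "hecke_mult N N0 (lift f1) (lift f2) (v, g) = (\<Sum>C\<in>?X. ?t C)"
        using v g by (simp add: hecke_mult_eq_sum)
      also have "\<dots> = (\<Sum>C\<in>?X. ?t' (snd ` C))"
        using coset by (intro sum.cong) blast+
      also have "\<dots> = (\<Sum>D\<in>?Y. ?t' D)"
        by (rule sum.reindex_bij_betw[OF bij])
      also have "\<dots> = lift (hecke_mult G \<Gamma> f1 f2) (v, g)"
        using True g by (simp add: lift_def hecke_mult_eq_sum)
      finally show ?thesis by simp
    qed
  qed
qed

lemma lift_alg_hom:
  "lift \<in> alg_hom (hecke_subalgebra G S \<Gamma>) (hecke_algebra N N0)" (is "_ \<in> alg_hom ?A ?B")
proof -
  have "lift f \<in> carrier ?B" if "f \<in> carrier ?A" for f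
    using lift_closed[OF that] by (simp add: hecke_algebra_def)
  moreover have "lift (f1 \<otimes>\<^bsub>?A\<^esub> f2) = lift f1 \<otimes>\<^bsub>?B\<^esub> lift f2"
    if "f1 \<in> carrier ?A" "f2 \<in> carrier ?A" for f1 f2
    using lift_mult[OF that] by (simp add: hecke_subalgebra_def hecke_algebra_def)
  moreover have "lift (f1 \<oplus>\<^bsub>?A\<^esub> f2) = lift f1 \<oplus>\<^bsub>?B\<^esub> lift f2" for f1 f2
    by (auto simp: lift_def hecke_subalgebra_def hecke_algebra_def)
  moreover have "lift \<one>\<^bsub>?A\<^esub> = \<one>\<^bsub>?B\<^esub>"
    using lift_one by (simp add: hecke_subalgebra_def hecke_algebra_def)
  moreover have "lift (c \<odot>\<^bsub>?A\<^esub> f) = c \<odot>\<^bsub>?B\<^esub> lift f" for c f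
    by (auto simp: lift_def hecke_subalgebra_def hecke_algebra_def)
  ultimately show ?thesis
    by (simp add: alg_hom_def ring_hom_def)
qed

end

theorem proposition1p6:
  fixes V :: "('v, 'm) monoid_scheme" and G :: "('g, 'n) monoid_scheme"
    and \<alpha> :: "'g \<Rightarrow> 'v \<Rightarrow> 'v" and V0 :: "'v set" and \<Gamma> S :: "'g set"
  assumes "group V" and "group G"
    and action: "group_hom G (AutoGroup V) \<alpha>"
    and "subgroup V0 V" and "subgroup \<Gamma> G"
    and invariant: "\<forall>g\<in>\<Gamma>. \<alpha> g ` V0 \<subseteq> V0"
    and pair: "hecke_pair (semidirect V G \<alpha>) (V0 \<times> \<Gamma>)"
    and S_eq: "S = {s \<in> carrier G. V0 \<subseteq> \<alpha> s ` V0}"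
  shows "subsemigroup S G \<and> \<Gamma> \<subseteq> S \<and>
    (\<exists>\<iota> \<in> alg_hom (hecke_subalgebra G S \<Gamma>) (hecke_algebra (semidirect V G \<alpha>) (V0 \<times> \<Gamma>)).
       (\<forall>s\<in>S. \<iota> (hecke_char G \<Gamma> s) = hecke_char (semidirect V G \<alpha>) (V0 \<times> \<Gamma>) (\<one>\<^bsub>V\<^esub>, s)) \<and>
       inj_on \<iota> (carrier (hecke_subalgebra G S \<Gamma>)))"
proof -
  interpret hs: hecke_semidirect V G \<alpha> V0 \<Gamma>
    by (intro hecke_semidirect.intro hecke_semidirect_axioms.intro)
      (fact assms | erule bspec[OF invariant])+
  have S: "S = hs.S"
    unfolding S_eq hs.S_def ..
  show ?thesis
    unfolding S
    by (intro conjI bexI[OF _ hs.lift_alg_hom] ballI hs.subsemigroup_S hs.\<Gamma>_subset_S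
        hs.lift_hecke_char hs.lift_inj_on)
qed

end
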